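(* Let $u^*$ be an optimal input solution, with its corresponding decision variable $g^*$ and output trajectory $y^*$, of $$\mathbf{P}_1:\quad\min_{g,u,y}\ y^T\mathcal{Q}y+u^T\mathcal{R}u\quad\text{s.t.}\quad H g=\operatorname{col}(u^{\mathrm{ini}},y^{\mathrm{ini}},u,y),\qquad H:=H_{T_{\mathrm{ini}}+N}(w^d).$$ Then there is a multiplier (costate) $\lambda^*=\operatorname{col}(\lambda^*_{\mathrm{ini}},\lambda^*_u,\lambda^*_y)$, partitioned conformally with $\operatorname{col}(\operatorname{col}(u^{\mathrm{ini}},y^{\mathrm{ini}}),u,y)$, such that, with the Lagrangian $$L(g,u,y,\lambda)=y^T\mathcal{Q}y+u^T\mathcal{R}u+\lambda^T\big(Hg-\operatorname{col}(u^{\mathrm{ini}},y^{\mathrm{ini}},u,y)\big),$$ the following hold at $(g^*,u^*,y^*,\lambda^* )$: $$\frac{\partial L}{\partial g}={\lambda^*}^TH=0,\qquad\frac{\partial L}{\partial u}=2\mathcal{R}u^*-\lambda^*_u=0,\qquad\frac{\partial L}{\partial y}=2\mathcal{Q}y^*-\lambda^*_y=0,$$ $$\frac{\partial L}{\partial\lambda}=Hg^*-\operatorname{col}(u^{\mathrm{ini}},y^{\mathrm{ini}},u^*,y^* )=0 .$$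
   Context: $w^d=\{u^d_k,y^d_k\}_{k=0}^{T-1}$ is an input-output trajectory of an LTI system $x_{k+1}=Ax_k+Bu_k$, $y_k=Cx_k+Du_k$ with $m$ inputs and $p$ outputs. For a signal $v=\{v_k\}_{k=0}^{T-1}$ the Hankel matrix $\mathcal{H}_L(v)$ has $L$ block rows and $T-L+1$ columns, with $(i,j)$ block $v_{i+j}$. Partition $\operatorname{col}(U_p,U_f)=\mathcal{H}_{T_{\mathrm{ini}}+N}(u^d)$, $\operatorname{col}(Y_p,Y_f)=\mathcal{H}_{T_{\mathrm{ini}}+N}(y^d)$, with $U_p,Y_p$ the first $T_{\mathrm{ini}}$ and $U_f,Y_f$ the last $N$ block rows; $H_{T_{\mathrm{ini}}+N}(w^d)=\operatorname{col}(U_p,Y_p,U_f,Y_f)$. $u^{\mathrm{ini}}\in\mathbb{R}^{mT_{\mathrm{ini}}}$, $y^{\mathrm{ini}}\in\mathbb{R}^{pT_{\mathrm{ini}}}$ are the stacked inputs and outputs of a given $T_{\mathrm{ini}}$-length trajectory of the system. $\mathcal{Q}=\operatorname{diag}(Q,\dots,Q)$, $\mathcal{R}=\operatorname{diag}(R,\dots,R)$ ($N$ blocks each) with $Q\in\mathbb{S}^p$, $R\in\mathbb{S}^m$ positive definite; $u\in\mathbb{R}^{mN}$, $y\in\mathbb{R}^{pN}$, $g\in\mathbb{R}^{T-T_{\mathrm{ini}}-N+1}$. Row/column layout of derivatives is not distinguished. *)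

theory Defs
  imports Complex_Main "Jordan_Normal_Form.Matrix"
begin

text \<open>Signals are functions on \<^typ>\<open>nat\<close> of which only the first \<open>L\<close> samples matter. The state
  dimension \<open>n\<close> and the input and output dimensions are explicit parameters. The state \<open>x L\<close>
  after the last sample is only constrained by the state equation, so it adds no restriction.\<close>

definition lti_system ::
  "nat \<Rightarrow> nat \<Rightarrow> nat \<Rightarrow> real mat \<Rightarrow> real mat \<Rightarrow> real mat \<Rightarrow> real mat \<Rightarrow> bool" where
  "lti_system n m p A B C D \<longleftrightarrow>
     A \<in> carrier_mat n n \<and> B \<in> carrier_mat n m \<and> C \<in> carrier_mat p n \<and> D \<in> carrier_mat p m"

definition io_trajectory ::
  "nat \<Rightarrow> nat \<Rightarrow> nat \<Rightarrow> real mat \<Rightarrow> real mat \<Rightarrow> real mat \<Rightarrow> real mat \<Rightarrow>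
   nat \<Rightarrow> (nat \<Rightarrow> real vec) \<Rightarrow> (nat \<Rightarrow> real vec) \<Rightarrow> bool" where
  "io_trajectory n m p A B C D L u y \<longleftrightarrow>
     (\<forall>k<L. u k \<in> carrier_vec m \<and> y k \<in> carrier_vec p) \<and>
     (\<exists>x. (\<forall>k\<le>L. x k \<in> carrier_vec n) \<and>
          (\<forall>k<L. x (Suc k) = A *\<^sub>v x k + B *\<^sub>v u k \<and> y k = C *\<^sub>v x k + D *\<^sub>v u k))"

definition stacked :: "nat \<Rightarrow> nat \<Rightarrow> (nat \<Rightarrow> real vec) \<Rightarrow> real vec" where
  "stacked q L v = vec (q * L) (\<lambda>i. v (i div q) $ (i mod q))"

text \<open>Hankel matrix with \<open>L\<close> block rows of a signal of length \<open>T\<close> with values in dimension \<open>q\<close>.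
  The truncated subtraction gives the intended number of columns only for \<open>L \<le> T\<close>.\<close>

definition hankel :: "nat \<Rightarrow> nat \<Rightarrow> nat \<Rightarrow> (nat \<Rightarrow> real vec) \<Rightarrow> real mat" where
  "hankel q T L v = mat (q * L) (T - L + 1) (\<lambda>(i, j). v (i div q + j) $ (i mod q))"

definition row_slice :: "real mat \<Rightarrow> nat \<Rightarrow> nat \<Rightarrow> real mat" where
  "row_slice M a k = mat k (dim_col M) (\<lambda>(i, j). M $$ (a + i, j))"

definition data_matrix ::
  "nat \<Rightarrow> nat \<Rightarrow> nat \<Rightarrow> nat \<Rightarrow> nat \<Rightarrow> (nat \<Rightarrow> real vec) \<Rightarrow> (nat \<Rightarrow> real vec) \<Rightarrow> real mat" where
  "data_matrix m p T Tini N u y =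
     (let Hu = hankel m T (Tini + N) u;
          Hy = hankel p T (Tini + N) y;
          Up = row_slice Hu 0 (m * Tini); Uf = row_slice Hu (m * Tini) (m * N);
          Yp = row_slice Hy 0 (p * Tini); Yf = row_slice Hy (p * Tini) (p * N)
      in Up @\<^sub>r Yp @\<^sub>r Uf @\<^sub>r Yf)"

definition symmetric_posdef :: "nat \<Rightarrow> real mat \<Rightarrow> bool" where
  "symmetric_posdef q M \<longleftrightarrow>
     M \<in> carrier_mat q q \<and> transpose_mat M = M \<and>
     (\<forall>x \<in> carrier_vec q. x \<noteq> 0\<^sub>v q \<longrightarrow> x \<bullet> (M *\<^sub>v x) > 0)"

definition repeat_diag :: "nat \<Rightarrow> real mat \<Rightarrow> real mat" where
  "repeat_diag N M = diag_block_mat (replicate N M)"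

definition quad_cost :: "real mat \<Rightarrow> real mat \<Rightarrow> real vec \<Rightarrow> real vec \<Rightarrow> real" where
  "quad_cost QQ RR u y = y \<bullet> (QQ *\<^sub>v y) + u \<bullet> (RR *\<^sub>v u)"

definition P1_feasible ::
  "nat \<Rightarrow> nat \<Rightarrow> nat \<Rightarrow> nat \<Rightarrow> nat \<Rightarrow> real mat \<Rightarrow> real vec \<Rightarrow> real vec \<Rightarrow>
   real vec \<times> real vec \<times> real vec \<Rightarrow> bool" where
  "P1_feasible m p T Tini N H uini yini = (\<lambda>(g, u, y).
     g \<in> carrier_vec (T - (Tini + N) + 1) \<and> u \<in> carrier_vec (m * N) \<and> y \<in> carrier_vec (p * N) \<and>
     H *\<^sub>v g = (uini @\<^sub>v yini) @\<^sub>v u @\<^sub>v y)"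

definition P1_optimal ::
  "nat \<Rightarrow> nat \<Rightarrow> nat \<Rightarrow> nat \<Rightarrow> nat \<Rightarrow> real mat \<Rightarrow> real mat \<Rightarrow> real mat \<Rightarrow> real vec \<Rightarrow> real vec \<Rightarrow>
   real vec \<times> real vec \<times> real vec \<Rightarrow> bool" where
  "P1_optimal m p T Tini N QQ RR H uini yini =
     is_arg_min (\<lambda>(g, u, y). quad_cost QQ RR u y) (P1_feasible m p T Tini N H uini yini)"

definition lagrangian ::
  "real mat \<Rightarrow> real mat \<Rightarrow> real mat \<Rightarrow> real vec \<Rightarrow> real vec \<Rightarrow>
   real vec \<Rightarrow> real vec \<Rightarrow> real vec \<Rightarrow> real vec \<Rightarrow> real" where
  "lagrangian QQ RR H uini yini g u y l =
     quad_cost QQ RR u y + l \<bullet> (H *\<^sub>v g - ((uini @\<^sub>v yini) @\<^sub>v u @\<^sub>v y))"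

text \<open>\<open>d\<close> is the vector of all partial derivatives of \<open>f\<close> at \<open>x\<close>.\<close>

definition has_partials :: "(real vec \<Rightarrow> real) \<Rightarrow> real vec \<Rightarrow> real vec \<Rightarrow> bool" where
  "has_partials f d x \<longleftrightarrow>
     dim_vec d = dim_vec x \<and>
     (\<forall>j < dim_vec x.
        ((\<lambda>t. f (x + t \<cdot>\<^sub>v unit_vec (dim_vec x) j)) has_real_derivative d $ j) (at 0))"

end

theory Submission
  imports Defs
begin

text \<open>Split the rows of \<open>H\<close> into the block \<open>P\<close> that reproduces the initial trajectory and the
  blocks \<open>Fu\<close> and \<open>Fy\<close> that produce the future input and output. If \<open>P d = 0\<close>, then moving \<open>g\<close>
  along \<open>d\<close> keeps the initial trajectory, and \<open>(g + t d, u + t Fu d, y + t Fy d)\<close> is feasible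
  for every real \<open>t\<close>. Optimality makes the cost along this line, a quadratic polynomial
  in \<open>t\<close>, minimal at \<open>t = 0\<close>, so its linear coefficient vanishes. Hence the gradient
  \<open>G = Fu\<^sup>T (2 RR u) + Fy\<^sup>T (2 QQ y)\<close> of the reduced cost is orthogonal to the kernel of \<open>P\<close>.

  In finite dimension, a vector orthogonal to the kernel of \<open>P\<close> is a combination of the rows of
  \<open>P\<close> (\<open>orthogonal_to_kernel_in_row_space\<close>). The coefficients that express \<open>- G\<close> are the
  multiplier of the initial trajectory. The other two multipliers are prescribed by the derivatives
  in \<open>u\<close> and \<open>y\<close>, namely \<open>2 RR u\<close> and \<open>2 QQ y\<close>. With these choices,
  stationarity in \<open>g\<close> says exactly \<open>P\<^sup>T \<lambda>\<^sub>i\<^sub>n\<^sub>i + G = 0\<close> (\<open>stationary_multiplier\<close>), and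
  stationarity in \<open>\<lambda>\<close> is feasibility.

  The partial derivatives of the Lagrangian are read off from the same observation: along each
  coordinate axis it is a polynomial of degree at most two in the step.\<close>

section \<open>Derivatives of quadratic polynomials along coordinate axes\<close>

lemma DERIV_quadratic_at_0:
  "((\<lambda>t. \<alpha> + t * \<beta> + t\<^sup>2 * \<gamma>) has_real_derivative \<beta>) (at 0)" for \<alpha> \<beta> \<gamma> :: real
  by (auto intro!: derivative_eq_intros)

text \<open>First-order optimality in the only form needed here: a polynomial without constant term that
  is nonnegative on the whole line has a minimum at \<open>0\<close>.\<close>

lemma linear_coeff_eq_0_of_nonneg:
  fixes \<beta> \<gamma> :: real
  assumes "\<And>t. 0 \<le> t * \<beta> + t\<^sup>2 * \<gamma>"
  shows "\<beta> = 0"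
  using DERIV_local_min[OF DERIV_quadratic_at_0[of 0 \<beta> \<gamma>], of 1] assms by simp

lemma has_partials_of_quadratic_slices:
  assumes "dim_vec d = dim_vec x"
    and "\<And>j t. j < dim_vec x \<Longrightarrow>
      f (x + t \<cdot>\<^sub>v unit_vec (dim_vec x) j) = f x + t * d $ j + t\<^sup>2 * \<gamma> j"
  shows "has_partials f d x"
  unfolding has_partials_def
proof (intro conjI allI impI)
  fix j assume j: "j < dim_vec x"
  show "((\<lambda>t. f (x + t \<cdot>\<^sub>v unit_vec (dim_vec x) j)) has_real_derivative d $ j) (at 0)"
    unfolding assms(2)[OF j] by (rule DERIV_quadratic_at_0)
qed (fact assms(1))

section \<open>Orthogonality to a kernel\<close>

text \<open>Induction on the number of functionals. If \<open>a r\<close> already vanishes on the common kernel of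
  its predecessors, it can be dropped. Otherwise that kernel contains some \<open>d0\<close> with
  \<open>a r \<bullet> d0 \<noteq> 0\<close>. Subtracting from \<open>c\<close> the multiple of \<open>a r\<close> that makes it vanish at
  \<open>d0\<close> gives a functional to which the induction hypothesis applies, because every vector of the
  kernel of the predecessors is a multiple of \<open>d0\<close> plus a vector on which \<open>a r\<close> vanishes
  too.\<close>

lemma functional_vanishing_on_kernel_in_span:
  fixes c :: "real vec" and a :: "nat \<Rightarrow> real vec"
  assumes "\<And>i. i < r \<Longrightarrow> a i \<in> carrier_vec k" and "c \<in> carrier_vec k"
    and "\<And>d. d \<in> carrier_vec k \<Longrightarrow> (\<And>i. i < r \<Longrightarrow> a i \<bullet> d = 0) \<Longrightarrow> c \<bullet> d = 0"
  shows "\<exists>\<mu>. \<forall>d\<in>carrier_vec k. c \<bullet> d = (\<Sum>i<r. \<mu> i * (a i \<bullet> d))"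
  using assms
proof (induction r arbitrary: c)
  case 0
  then show ?case by simp
next
  case (Suc r)
  show ?case
  proof (cases "\<forall>d\<in>carrier_vec k. (\<forall>i<r. a i \<bullet> d = 0) \<longrightarrow> a r \<bullet> d = 0")
    case True
    have "\<exists>\<mu>. \<forall>d\<in>carrier_vec k. c \<bullet> d = (\<Sum>i<r. \<mu> i * (a i \<bullet> d))"
    proof (rule Suc.IH)
      fix d :: "real vec" assume d: "d \<in> carrier_vec k" and z: "\<And>i. i < r \<Longrightarrow> a i \<bullet> d = 0"
      show "c \<bullet> d = 0"
      proof (rule Suc.prems(3)[OF d])
        fix i assume "i < Suc r"
        then show "a i \<bullet> d = 0" using z True d by (cases "i = r") auto
      qed
    qed (use Suc.prems in auto)
    then obtain \<mu> where \<mu>: "\<forall>d\<in>carrier_vec k. c \<bullet> d = (\<Sum>i<r. \<mu> i * (a i \<bullet> d))" ..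
    have "\<forall>d\<in>carrier_vec k. c \<bullet> d = (\<Sum>i<Suc r. (\<mu>(r := 0)) i * (a i \<bullet> d))"
      using \<mu> by simp
    then show ?thesis by (rule exI[where x = "\<mu>(r := 0)"])
  next
    case False
    then obtain d0 where d0: "d0 \<in> carrier_vec k" "\<And>i. i < r \<Longrightarrow> a i \<bullet> d0 = 0" "a r \<bullet> d0 \<noteq> 0"
      by blast
    define s where "s = (c \<bullet> d0) / (a r \<bullet> d0)"
    have ar: "a r \<in> carrier_vec k" using Suc.prems(1) by simp
    have minus: "(c - s \<cdot>\<^sub>v a r) \<bullet> d = c \<bullet> d - s * (a r \<bullet> d)" if "d \<in> carrier_vec k" for d
      using minus_scalar_prod_distrib[of c k "s \<cdot>\<^sub>v a r" d] Suc.prems(2) ar that by simp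
    have "\<exists>\<mu>. \<forall>d\<in>carrier_vec k. (c - s \<cdot>\<^sub>v a r) \<bullet> d = (\<Sum>i<r. \<mu> i * (a i \<bullet> d))"
    proof (rule Suc.IH)
      fix d :: "real vec" assume d: "d \<in> carrier_vec k" and z: "\<And>i. i < r \<Longrightarrow> a i \<bullet> d = 0"
      \<comment> \<open>\<open>\<tau>\<close> is chosen so that \<open>a r\<close> vanishes at \<open>d - \<tau> d0\<close>\<close>
      define \<tau> where "\<tau> = (a r \<bullet> d) / (a r \<bullet> d0)"
      have split: "v \<bullet> (d - \<tau> \<cdot>\<^sub>v d0) = v \<bullet> d - \<tau> * (v \<bullet> d0)" if "v \<in> carrier_vec k" for v
        using scalar_prod_minus_distrib[of v k d "\<tau> \<cdot>\<^sub>v d0"] that d d0(1) by simp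
      have "c \<bullet> (d - \<tau> \<cdot>\<^sub>v d0) = 0"
      proof (rule Suc.prems(3))
        fix i assume i: "i < Suc r"
        show "a i \<bullet> (d - \<tau> \<cdot>\<^sub>v d0) = 0"
          unfolding split[OF Suc.prems(1)[OF i]]
          using i z d0(2,3) by (cases "i = r") (auto simp: \<tau>_def)
      qed (use d d0(1) in auto)
      then show "(c - s \<cdot>\<^sub>v a r) \<bullet> d = 0"
        unfolding split[OF Suc.prems(2)] minus[OF d] by (simp add: s_def \<tau>_def)
    qed (use Suc.prems ar in auto)
    then obtain \<mu> where \<mu>: "\<forall>d\<in>carrier_vec k. (c - s \<cdot>\<^sub>v a r) \<bullet> d = (\<Sum>i<r. \<mu> i * (a i \<bullet> d))" ..
    have "\<forall>d\<in>carrier_vec k. c \<bullet> d = (\<Sum>i<Suc r. (\<mu>(r := s)) i * (a i \<bullet> d))"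
    proof
      fix d :: "real vec" assume d: "d \<in> carrier_vec k"
      show "c \<bullet> d = (\<Sum>i<Suc r. (\<mu>(r := s)) i * (a i \<bullet> d))"
        using \<mu>[rule_format, OF d] minus[OF d] by simp
    qed
    then show ?thesis by (rule exI[where x = "\<mu>(r := s)"])
  qed
qed

text \<open>The nontrivial half of the identity between the row space of \<open>P\<close> and the orthogonal complement
  of its kernel. The equation \<open>c = P\<^sup>T l\<close> is stated through its pairing with \<open>d\<close>, the form in
  which it combines with the pairings of the other row blocks of the constraint.\<close>

lemma orthogonal_to_kernel_in_row_space:
  fixes P :: "real mat"
  assumes P: "P \<in> carrier_mat r k" and c: "c \<in> carrier_vec k"
    and ker: "\<And>d. d \<in> carrier_vec k \<Longrightarrow> P *\<^sub>v d = 0\<^sub>v r \<Longrightarrow> c \<bullet> d = 0"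
  obtains l where "l \<in> carrier_vec r" and "\<And>d. d \<in> carrier_vec k \<Longrightarrow> c \<bullet> d = l \<bullet> (P *\<^sub>v d)"
proof -
  have "\<exists>\<mu>. \<forall>d\<in>carrier_vec k. c \<bullet> d = (\<Sum>i<r. \<mu> i * (row P i \<bullet> d))"
  proof (rule functional_vanishing_on_kernel_in_span)
    fix d :: "real vec" assume d: "d \<in> carrier_vec k" and z: "\<And>i. i < r \<Longrightarrow> row P i \<bullet> d = 0"
    have "P *\<^sub>v d = 0\<^sub>v r"
      using P z by (intro eq_vecI) auto
    then show "c \<bullet> d = 0" by (rule ker[OF d])
  qed (use P c in auto)
  then obtain \<mu> where \<mu>: "\<forall>d\<in>carrier_vec k. c \<bullet> d = (\<Sum>i<r. \<mu> i * (row P i \<bullet> d))" ..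
  show ?thesis
  proof
    show "vec r \<mu> \<in> carrier_vec r" by simp
    fix d :: "real vec" assume d: "d \<in> carrier_vec k"
    show "c \<bullet> d = vec r \<mu> \<bullet> (P *\<^sub>v d)"
      using \<mu> d P by (simp add: scalar_prod_def lessThan_atLeast0)
  qed
qed

section \<open>Structure of the cost and of the data matrix\<close>

text \<open>Symmetry merges the two mixed terms into \<open>2 t (M x) \<bullet> e\<close>; this is where the factor
  \<open>2\<close> in the gradient comes from.\<close>

lemma symmetric_quadratic_form_expand:
  fixes M :: "real mat"
  assumes M: "M \<in> carrier_mat k k" and sym: "transpose_mat M = M"
    and x: "x \<in> carrier_vec k" and e: "e \<in> carrier_vec k"
  shows "(x + t \<cdot>\<^sub>v e) \<bullet> (M *\<^sub>v (x + t \<cdot>\<^sub>v e)) =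
    x \<bullet> (M *\<^sub>v x) + t * ((2 \<cdot>\<^sub>v (M *\<^sub>v x)) \<bullet> e) + t\<^sup>2 * (e \<bullet> (M *\<^sub>v e))"
proof -
  have adj: "(M *\<^sub>v x) \<bullet> e = x \<bullet> (M *\<^sub>v e)"
    using transpose_vec_mult_scalar[OF M e x] sym by simp
  have comm: "e \<bullet> (M *\<^sub>v x) = (M *\<^sub>v x) \<bullet> e"
    using comm_scalar_prod[OF e] M x by simp
  have Mx: "M *\<^sub>v x \<in> carrier_vec k" and Me: "M *\<^sub>v e \<in> carrier_vec k" using M x e by auto
  have "(x + t \<cdot>\<^sub>v e) \<bullet> (M *\<^sub>v (x + t \<cdot>\<^sub>v e)) = (x + t \<cdot>\<^sub>v e) \<bullet> (M *\<^sub>v x + t \<cdot>\<^sub>v (M *\<^sub>v e))"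
    using M x e by (simp add: mult_add_distrib_mat_vec mult_mat_vec)
  also have "\<dots> = x \<bullet> (M *\<^sub>v x) + t * (x \<bullet> (M *\<^sub>v e)) + (t * (e \<bullet> (M *\<^sub>v x)) + t * (t * (e \<bullet> (M *\<^sub>v e))))"
    using x e Mx Me
    by (simp add: add_scalar_prod_distrib[of _ k] scalar_prod_add_distrib[of _ k] algebra_simps)
  also have "\<dots> = x \<bullet> (M *\<^sub>v x) + t * ((2 \<cdot>\<^sub>v (M *\<^sub>v x)) \<bullet> e) + t\<^sup>2 * (e \<bullet> (M *\<^sub>v e))"
    using Mx e by (simp add: adj[symmetric] comm power2_eq_square algebra_simps)
  finally show ?thesis .
qed

lemma repeat_diag_symmetric:
  assumes M: "M \<in> carrier_mat q q" and sym: "transpose_mat M = M"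
  shows "repeat_diag N M \<in> carrier_mat (q * N) (q * N) \<and>
    transpose_mat (repeat_diag N M) = repeat_diag N M"
proof (induction N)
  case 0
  then show ?case by (auto simp: repeat_diag_def)
next
  case (Suc N)
  let ?D = "repeat_diag N M"
  from Suc have D: "?D \<in> carrier_mat (q * N) (q * N)" and symD: "transpose_mat ?D = ?D" by auto
  have step: "repeat_diag (Suc N) M = four_block_mat M (0\<^sub>m q (q * N)) (0\<^sub>m (q * N) q) ?D"
    using M D by (simp add: repeat_diag_def Let_def)
  have "transpose_mat (repeat_diag (Suc N) M) = repeat_diag (Suc N) M"
    unfolding step
    by (subst transpose_four_block_mat[OF M _ _ D]) (auto simp: sym symD)
  moreover have "repeat_diag (Suc N) M \<in> carrier_mat (q * Suc N) (q * Suc N)"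
    unfolding step using four_block_carrier_mat[OF M D] by simp
  ultimately show ?case by blast
qed

lemma append_rows_assoc:
  assumes "A \<in> carrier_mat a k" "B \<in> carrier_mat b k" "C \<in> carrier_mat c k"
  shows "A @\<^sub>r B @\<^sub>r C = (A @\<^sub>r B) @\<^sub>r C"
  using assms by (intro eq_matI) (auto simp: append_rows_def)

text \<open>All that matters about the data matrix is its shape: past rows \<open>P\<close>, future input rows
  \<open>Fu\<close> and future output rows \<open>Fy\<close>. Grouping \<open>Up\<close> and \<open>Yp\<close> into a
  single block matches the grouping \<open>uini @\<^sub>v yini\<close> in the constraint.\<close>

lemma data_matrix_blocks:
  obtains P Fu Fy where
    "P \<in> carrier_mat (m * Tini + p * Tini) (T - (Tini + N) + 1)"
    "Fu \<in> carrier_mat (m * N) (T - (Tini + N) + 1)"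
    "Fy \<in> carrier_mat (p * N) (T - (Tini + N) + 1)"
    "data_matrix m p T Tini N u y = P @\<^sub>r Fu @\<^sub>r Fy"
proof -
  let ?Hu = "hankel m T (Tini + N) u" and ?Hy = "hankel p T (Tini + N) y"
  let ?k = "T - (Tini + N) + 1"
  have slice: "row_slice (hankel q T (Tini + N) v) a r \<in> carrier_mat r ?k" for q v a r
    by (simp add: row_slice_def hankel_def)
  show ?thesis
  proof
    show "row_slice ?Hu 0 (m * Tini) @\<^sub>r row_slice ?Hy 0 (p * Tini)
        \<in> carrier_mat (m * Tini + p * Tini) ?k"
      by (intro carrier_append_rows slice)
    show "data_matrix m p T Tini N u y =
      (row_slice ?Hu 0 (m * Tini) @\<^sub>r row_slice ?Hy 0 (p * Tini)) @\<^sub>r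
        row_slice ?Hu (m * Tini) (m * N) @\<^sub>r row_slice ?Hy (p * Tini) (p * N)"
      unfolding data_matrix_def Let_def
      by (rule append_rows_assoc[OF slice slice carrier_append_rows[OF slice slice]])
  qed (rule slice)+
qed

section \<open>Existence of the multiplier\<close>

text \<open>The minimality hypothesis quantifies over directions \<open>d\<close> in the kernel of \<open>P\<close>, the
  directions in which \<open>g\<close> can move without changing the initial trajectory. It mentions no step size
  because the kernel is closed under scaling.\<close>

lemma stationary_multiplier:
  fixes P Fu Fy QQ RR :: "real mat"
  assumes P: "P \<in> carrier_mat a k" and Fu: "Fu \<in> carrier_mat b k" and Fy: "Fy \<in> carrier_mat c k"
    and RR: "RR \<in> carrier_mat b b" "transpose_mat RR = RR"
    and QQ: "QQ \<in> carrier_mat c c" "transpose_mat QQ = QQ"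
    and us: "us \<in> carrier_vec b" and ys: "ys \<in> carrier_vec c"
    and min: "\<And>d. d \<in> carrier_vec k \<Longrightarrow> P *\<^sub>v d = 0\<^sub>v a \<Longrightarrow>
      quad_cost QQ RR us ys \<le> quad_cost QQ RR (us + Fu *\<^sub>v d) (ys + Fy *\<^sub>v d)"
  obtains lini where "lini \<in> carrier_vec a"
    and "transpose_mat (P @\<^sub>r Fu @\<^sub>r Fy) *\<^sub>v (lini @\<^sub>v 2 \<cdot>\<^sub>v (RR *\<^sub>v us) @\<^sub>v 2 \<cdot>\<^sub>v (QQ *\<^sub>v ys)) = 0\<^sub>v k"
proof -
  let ?lu = "2 \<cdot>\<^sub>v (RR *\<^sub>v us)" and ?ly = "2 \<cdot>\<^sub>v (QQ *\<^sub>v ys)"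
  \<comment> \<open>the gradient of the cost as a function of \<open>g\<close>, with \<open>u\<close> and \<open>y\<close> eliminated\<close>
  define G where "G = transpose_mat Fu *\<^sub>v ?lu + transpose_mat Fy *\<^sub>v ?ly"
  have lu: "?lu \<in> carrier_vec b" and ly: "?ly \<in> carrier_vec c" using RR(1) QQ(1) us ys by auto
  have G: "G \<in> carrier_vec k"
    using Fu Fy lu ly by (simp add: G_def)
  have G_prod: "G \<bullet> d = ?lu \<bullet> (Fu *\<^sub>v d) + ?ly \<bullet> (Fy *\<^sub>v d)" if d: "d \<in> carrier_vec k" for d
    unfolding G_def
    using add_scalar_prod_distrib[of "transpose_mat Fu *\<^sub>v ?lu" k "transpose_mat Fy *\<^sub>v ?ly" d]
      transpose_vec_mult_scalar[OF Fu d lu] transpose_vec_mult_scalar[OF Fy d ly] Fu Fy lu ly d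
    by simp
  have kernel: "(- G) \<bullet> d = 0" if d: "d \<in> carrier_vec k" and Pd: "P *\<^sub>v d = 0\<^sub>v a" for d
  proof -
    have Fud: "Fu *\<^sub>v d \<in> carrier_vec b" and Fyd: "Fy *\<^sub>v d \<in> carrier_vec c"
      using Fu Fy d by auto
    have "0 \<le> t * (G \<bullet> d) + t\<^sup>2 * quad_cost QQ RR (Fu *\<^sub>v d) (Fy *\<^sub>v d)" for t
    proof -
      have "P *\<^sub>v (t \<cdot>\<^sub>v d) = 0\<^sub>v a" using mult_mat_vec[OF P d] Pd by auto
      then have "quad_cost QQ RR us ys \<le>
          quad_cost QQ RR (us + t \<cdot>\<^sub>v (Fu *\<^sub>v d)) (ys + t \<cdot>\<^sub>v (Fy *\<^sub>v d))"
        using min[of "t \<cdot>\<^sub>v d"] d mult_mat_vec[OF Fu d] mult_mat_vec[OF Fy d] by simp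
      then show ?thesis
        unfolding quad_cost_def G_prod[OF d]
          symmetric_quadratic_form_expand[OF RR us Fud] symmetric_quadratic_form_expand[OF QQ ys Fyd]
        by (simp add: algebra_simps)
    qed
    then have "G \<bullet> d = 0" by (rule linear_coeff_eq_0_of_nonneg)
    then show ?thesis using G d by simp
  qed
  obtain lini where lini: "lini \<in> carrier_vec a"
    and row_space: "\<And>d. d \<in> carrier_vec k \<Longrightarrow> (- G) \<bullet> d = lini \<bullet> (P *\<^sub>v d)"
    using orthogonal_to_kernel_in_row_space[OF P uminus_carrier_vec[THEN iffD2, OF G] kernel] by blast
  let ?H = "P @\<^sub>r Fu @\<^sub>r Fy" and ?l = "lini @\<^sub>v ?lu @\<^sub>v ?ly"
  have H: "?H \<in> carrier_mat (a + (b + c)) k" using P Fu Fy by auto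
  have l: "?l \<in> carrier_vec (a + (b + c))" using lini lu ly by auto
  have orth: "(transpose_mat ?H *\<^sub>v ?l) \<bullet> d = 0" if d: "d \<in> carrier_vec k" for d
  proof -
    have "(transpose_mat ?H *\<^sub>v ?l) \<bullet> d = ?l \<bullet> (?H *\<^sub>v d)"
      by (rule transpose_vec_mult_scalar[OF H d l])
    also have "?H *\<^sub>v d = P *\<^sub>v d @\<^sub>v Fu *\<^sub>v d @\<^sub>v Fy *\<^sub>v d"
      using mat_mult_append[OF P carrier_append_rows[OF Fu Fy] d] mat_mult_append[OF Fu Fy d] by simp
    also have "?l \<bullet> \<dots> = lini \<bullet> (P *\<^sub>v d) + (?lu \<bullet> (Fu *\<^sub>v d) + ?ly \<bullet> (Fy *\<^sub>v d))"
      using lini lu ly P Fu Fy d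
      by (simp add: scalar_prod_append[of _ a _ "b + c"] scalar_prod_append[of _ b _ c])
    also have "\<dots> = 0"
      using row_space[OF d] G_prod[OF d] G d by simp
    finally show ?thesis .
  qed
  have "transpose_mat ?H *\<^sub>v ?l = 0\<^sub>v k"
  proof (intro eq_vecI)
    fix j assume "j < dim_vec (0\<^sub>v k :: real vec)"
    then have j: "j < k" by simp
    then show "(transpose_mat ?H *\<^sub>v ?l) $ j = 0\<^sub>v k $ j"
      using orth[OF unit_vec_carrier, of j] by (simp only: scalar_prod_right_unit index_zero_vec)
  qed (use H in simp)
  with lini show ?thesis by (rule that)
qed

section \<open>Partial derivatives of the Lagrangian\<close>

text \<open>Moving \<open>H\<close> to the other side of the scalar product and splitting the multiplier separates the
  variables: what remains is affine in \<open>g\<close>, and quadratic in \<open>u\<close> and in \<open>y\<close>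
  without mixed terms.\<close>

lemma lagrangian_expand:
  assumes H: "H \<in> carrier_mat (a + (b + c)) k" and g: "g \<in> carrier_vec k"
    and w: "uini @\<^sub>v yini \<in> carrier_vec a" and u: "u \<in> carrier_vec b" and y: "y \<in> carrier_vec c"
    and lini: "lini \<in> carrier_vec a" and lu: "lu \<in> carrier_vec b" and ly: "ly \<in> carrier_vec c"
  shows "lagrangian QQ RR H uini yini g u y (lini @\<^sub>v lu @\<^sub>v ly) =
    quad_cost QQ RR u y + (transpose_mat H *\<^sub>v (lini @\<^sub>v lu @\<^sub>v ly)) \<bullet> g
      - (lini \<bullet> (uini @\<^sub>v yini) + lu \<bullet> u + ly \<bullet> y)"
proof -
  have l: "lini @\<^sub>v lu @\<^sub>v ly \<in> carrier_vec (a + (b + c))" using lini lu ly by auto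
  have v: "(uini @\<^sub>v yini) @\<^sub>v u @\<^sub>v y \<in> carrier_vec (a + (b + c))" using w u y by auto
  have "(lini @\<^sub>v lu @\<^sub>v ly) \<bullet> (H *\<^sub>v g - ((uini @\<^sub>v yini) @\<^sub>v u @\<^sub>v y)) =
    (lini @\<^sub>v lu @\<^sub>v ly) \<bullet> (H *\<^sub>v g) - (lini @\<^sub>v lu @\<^sub>v ly) \<bullet> ((uini @\<^sub>v yini) @\<^sub>v u @\<^sub>v y)"
    by (rule scalar_prod_minus_distrib[OF l _ v]) (use H g in auto)
  also have "(lini @\<^sub>v lu @\<^sub>v ly) \<bullet> (H *\<^sub>v g) = (transpose_mat H *\<^sub>v (lini @\<^sub>v lu @\<^sub>v ly)) \<bullet> g"
    by (rule transpose_vec_mult_scalar[OF H g l, symmetric])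
  also have "(lini @\<^sub>v lu @\<^sub>v ly) \<bullet> ((uini @\<^sub>v yini) @\<^sub>v u @\<^sub>v y) =
      lini \<bullet> (uini @\<^sub>v yini) + (lu \<bullet> u + ly \<bullet> y)"
    unfolding scalar_prod_append[OF lini append_carrier_vec[OF lu ly] w append_carrier_vec[OF u y]]
      scalar_prod_append[OF lu ly u y] ..
  finally show ?thesis by (simp add: lagrangian_def)
qed

lemma scalar_prod_add_unit:
  fixes v x :: "real vec"
  assumes "v \<in> carrier_vec k" "x \<in> carrier_vec k" "j < k"
  shows "v \<bullet> (x + t \<cdot>\<^sub>v unit_vec k j) = v \<bullet> x + t * v $ j"
  using assms by (simp add: scalar_prod_add_distrib[of _ k])

lemma lagrangian_partials:
  assumes H: "H \<in> carrier_mat (a + (b + c)) k" and g: "g \<in> carrier_vec k"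
    and w: "uini @\<^sub>v yini \<in> carrier_vec a" and u: "u \<in> carrier_vec b" and y: "y \<in> carrier_vec c"
    and lini: "lini \<in> carrier_vec a" and lu: "lu \<in> carrier_vec b" and ly: "ly \<in> carrier_vec c"
    and RR: "RR \<in> carrier_mat b b" "transpose_mat RR = RR"
    and QQ: "QQ \<in> carrier_mat c c" "transpose_mat QQ = QQ"
  defines "l \<equiv> lini @\<^sub>v lu @\<^sub>v ly"
  shows "has_partials (\<lambda>g. lagrangian QQ RR H uini yini g u y l) (transpose_mat H *\<^sub>v l) g"
    and "has_partials (\<lambda>u. lagrangian QQ RR H uini yini g u y l) (2 \<cdot>\<^sub>v (RR *\<^sub>v u) - lu) u"
    and "has_partials (\<lambda>y. lagrangian QQ RR H uini yini g u y l) (2 \<cdot>\<^sub>v (QQ *\<^sub>v y) - ly) y"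
    and "has_partials (\<lambda>l. lagrangian QQ RR H uini yini g u y l)
      (H *\<^sub>v g - ((uini @\<^sub>v yini) @\<^sub>v u @\<^sub>v y)) l"
proof -
  note expand = lagrangian_expand[OF H _ w _ _ lini lu ly, folded l_def]
  have l: "l \<in> carrier_vec (a + (b + c))" using lini lu ly by (auto simp: l_def)
  show "has_partials (\<lambda>g. lagrangian QQ RR H uini yini g u y l) (transpose_mat H *\<^sub>v l) g"
  proof (rule has_partials_of_quadratic_slices[where \<gamma> = "\<lambda>_. 0"])
    fix j t assume "j < dim_vec g"
    then have j: "j < k" using g by simp
    have HT: "transpose_mat H *\<^sub>v l \<in> carrier_vec k" using H l by simp
    have gt: "g + t \<cdot>\<^sub>v unit_vec k j \<in> carrier_vec k" using g by simp
    show "lagrangian QQ RR H uini yini (g + t \<cdot>\<^sub>v unit_vec (dim_vec g) j) u y l =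
      lagrangian QQ RR H uini yini g u y l + t * (transpose_mat H *\<^sub>v l) $ j + t\<^sup>2 * 0"
      unfolding carrier_vecD[OF g] expand[OF gt u y] expand[OF g u y] scalar_prod_add_unit[OF HT g j]
      by simp
  qed (use H g in simp)
  show "has_partials (\<lambda>u. lagrangian QQ RR H uini yini g u y l) (2 \<cdot>\<^sub>v (RR *\<^sub>v u) - lu) u"
  proof (rule has_partials_of_quadratic_slices)
    fix j t assume "j < dim_vec u"
    then have j: "j < b" using u by simp
    have ut: "u + t \<cdot>\<^sub>v unit_vec b j \<in> carrier_vec b" using u by simp
    show "lagrangian QQ RR H uini yini g (u + t \<cdot>\<^sub>v unit_vec (dim_vec u) j) y l =
      lagrangian QQ RR H uini yini g u y l + t * (2 \<cdot>\<^sub>v (RR *\<^sub>v u) - lu) $ j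
        + t\<^sup>2 * (unit_vec b j \<bullet> (RR *\<^sub>v unit_vec b j))"
      unfolding carrier_vecD[OF u] expand[OF g ut y] expand[OF g u y] scalar_prod_add_unit[OF lu u j]
        quad_cost_def symmetric_quadratic_form_expand[OF RR u unit_vec_carrier]
      using RR(1) u lu j by (simp add: algebra_simps del: index_mult_mat_vec)
  qed (use lu u in simp)
  show "has_partials (\<lambda>y. lagrangian QQ RR H uini yini g u y l) (2 \<cdot>\<^sub>v (QQ *\<^sub>v y) - ly) y"
  proof (rule has_partials_of_quadratic_slices)
    fix j t assume "j < dim_vec y"
    then have j: "j < c" using y by simp
    have yt: "y + t \<cdot>\<^sub>v unit_vec c j \<in> carrier_vec c" using y by simp
    show "lagrangian QQ RR H uini yini g u (y + t \<cdot>\<^sub>v unit_vec (dim_vec y) j) l =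
      lagrangian QQ RR H uini yini g u y l + t * (2 \<cdot>\<^sub>v (QQ *\<^sub>v y) - ly) $ j
        + t\<^sup>2 * (unit_vec c j \<bullet> (QQ *\<^sub>v unit_vec c j))"
      unfolding carrier_vecD[OF y] expand[OF g u yt] expand[OF g u y] scalar_prod_add_unit[OF ly y j]
        quad_cost_def symmetric_quadratic_form_expand[OF QQ y unit_vec_carrier]
      using QQ(1) y ly j by (simp add: algebra_simps del: index_mult_mat_vec)
  qed (use ly y in simp)
  let ?r = "H *\<^sub>v g - ((uini @\<^sub>v yini) @\<^sub>v u @\<^sub>v y)"
  have r: "?r \<in> carrier_vec (a + (b + c))"
    by (rule minus_carrier_vec) (use H g w u y in auto)
  show "has_partials (\<lambda>l. lagrangian QQ RR H uini yini g u y l) ?r l"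
  proof (rule has_partials_of_quadratic_slices[where \<gamma> = "\<lambda>_. 0"])
    fix j t assume "j < dim_vec l"
    then have j: "j < a + (b + c)" using l by simp
    have lt: "l + t \<cdot>\<^sub>v unit_vec (a + (b + c)) j \<in> carrier_vec (a + (b + c))" using l by simp
    show "lagrangian QQ RR H uini yini g u y (l + t \<cdot>\<^sub>v unit_vec (dim_vec l) j) =
      lagrangian QQ RR H uini yini g u y l + t * ?r $ j + t\<^sup>2 * 0"
      unfolding carrier_vecD[OF l] lagrangian_def comm_scalar_prod[OF lt r] comm_scalar_prod[OF l r]
        scalar_prod_add_unit[OF r l j] by simp
  qed (simp only: carrier_vecD[OF r] carrier_vecD[OF l])
qed

section \<open>The optimality conditions\<close>

theorem lemma4:
  fixes n m p T Tini N :: nat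
    and A B C D Q R QQ RR H :: "real mat"
    and ud yd ui yi :: "nat \<Rightarrow> real vec"
    and uini yini gs us ys :: "real vec"
  assumes "lti_system n m p A B C D"
    and "Tini + N \<le> T"
    and "io_trajectory n m p A B C D T ud yd"
    and "io_trajectory n m p A B C D Tini ui yi"
    and "uini = stacked m Tini ui" and "yini = stacked p Tini yi"
    and "symmetric_posdef p Q" and "symmetric_posdef m R"
    and "QQ = repeat_diag N Q" and "RR = repeat_diag N R"
    and "H = data_matrix m p T Tini N ud yd"
    and "P1_optimal m p T Tini N QQ RR H uini yini (gs, us, ys)"
  shows "\<exists>l lini lu ly.
    lini \<in> carrier_vec (m * Tini + p * Tini) \<and> lu \<in> carrier_vec (m * N) \<and> ly \<in> carrier_vec (p * N) \<and>
    l = lini @\<^sub>v lu @\<^sub>v ly \<and>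
    has_partials (\<lambda>g. lagrangian QQ RR H uini yini g us ys l) (transpose_mat H *\<^sub>v l) gs \<and>
    transpose_mat H *\<^sub>v l = 0\<^sub>v (T - (Tini + N) + 1) \<and>
    has_partials (\<lambda>u. lagrangian QQ RR H uini yini gs u ys l) (2 \<cdot>\<^sub>v (RR *\<^sub>v us) - lu) us \<and>
    2 \<cdot>\<^sub>v (RR *\<^sub>v us) - lu = 0\<^sub>v (m * N) \<and>
    has_partials (\<lambda>y. lagrangian QQ RR H uini yini gs us y l) (2 \<cdot>\<^sub>v (QQ *\<^sub>v ys) - ly) ys \<and>
    2 \<cdot>\<^sub>v (QQ *\<^sub>v ys) - ly = 0\<^sub>v (p * N) \<and>
    has_partials (\<lambda>l'. lagrangian QQ RR H uini yini gs us ys l')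
      (H *\<^sub>v gs - ((uini @\<^sub>v yini) @\<^sub>v us @\<^sub>v ys)) l \<and>
    H *\<^sub>v gs - ((uini @\<^sub>v yini) @\<^sub>v us @\<^sub>v ys) = 0\<^sub>v (m * Tini + p * Tini + (m * N + p * N))"
proof -
  let ?k = "T - (Tini + N) + 1" and ?a = "m * Tini + p * Tini"
  obtain P Fu Fy where P: "P \<in> carrier_mat ?a ?k" and Fu: "Fu \<in> carrier_mat (m * N) ?k"
    and Fy: "Fy \<in> carrier_mat (p * N) ?k" and H_blocks: "H = P @\<^sub>r Fu @\<^sub>r Fy"
    unfolding assms(11) by (rule data_matrix_blocks)
  have H: "H \<in> carrier_mat (?a + (m * N + p * N)) ?k"
    unfolding H_blocks using P Fu Fy by auto
  have QQ: "QQ \<in> carrier_mat (p * N) (p * N)" "transpose_mat QQ = QQ"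
    using repeat_diag_symmetric[of Q p N] assms(7,9) by (auto simp: symmetric_posdef_def)
  have RR: "RR \<in> carrier_mat (m * N) (m * N)" "transpose_mat RR = RR"
    using repeat_diag_symmetric[of R m N] assms(8,10) by (auto simp: symmetric_posdef_def)
  have w: "uini @\<^sub>v yini \<in> carrier_vec ?a"
    using assms(5,6) by (auto simp: stacked_def)
  note opt = assms(12)[unfolded P1_optimal_def is_arg_min_linorder]
  from opt have feas: "P1_feasible m p T Tini N H uini yini (gs, us, ys)" by simp
  then have gs: "gs \<in> carrier_vec ?k" and us: "us \<in> carrier_vec (m * N)"
    and ys: "ys \<in> carrier_vec (p * N)" and eq: "H *\<^sub>v gs = (uini @\<^sub>v yini) @\<^sub>v us @\<^sub>v ys"
    by (auto simp: P1_feasible_def)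
  have minimal: "quad_cost QQ RR us ys \<le> quad_cost QQ RR (us + Fu *\<^sub>v d) (ys + Fy *\<^sub>v d)"
    if d: "d \<in> carrier_vec ?k" and Pd: "P *\<^sub>v d = 0\<^sub>v ?a" for d
  proof -
    have Fud: "Fu *\<^sub>v d \<in> carrier_vec (m * N)" and Fyd: "Fy *\<^sub>v d \<in> carrier_vec (p * N)"
      using Fu Fy d by auto
    have "H *\<^sub>v d = 0\<^sub>v ?a @\<^sub>v Fu *\<^sub>v d @\<^sub>v Fy *\<^sub>v d"
      unfolding H_blocks
      using mat_mult_append[OF P carrier_append_rows[OF Fu Fy] d] mat_mult_append[OF Fu Fy d] Pd
      by simp
    then have "H *\<^sub>v (gs + d) = (uini @\<^sub>v yini) @\<^sub>v (us + Fu *\<^sub>v d) @\<^sub>v (ys + Fy *\<^sub>v d)"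
      unfolding mult_add_distrib_mat_vec[OF H gs d] eq
      using append_vec_add[OF w zero_carrier_vec append_carrier_vec[OF us ys] append_carrier_vec[OF Fud Fyd]]
        append_vec_add[OF us Fud ys Fyd] right_zero_vec[OF w] by simp
    then have "P1_feasible m p T Tini N H uini yini (gs + d, us + Fu *\<^sub>v d, ys + Fy *\<^sub>v d)"
      using gs us ys d Fud Fyd by (simp add: P1_feasible_def)
    then show ?thesis using opt by fastforce
  qed
  obtain lini where lini: "lini \<in> carrier_vec ?a"
    and stat: "transpose_mat H *\<^sub>v (lini @\<^sub>v 2 \<cdot>\<^sub>v (RR *\<^sub>v us) @\<^sub>v 2 \<cdot>\<^sub>v (QQ *\<^sub>v ys)) = 0\<^sub>v ?k"
    using stationary_multiplier[OF P Fu Fy RR QQ us ys minimal] unfolding H_blocks by blast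
  define lu ly where "lu = 2 \<cdot>\<^sub>v (RR *\<^sub>v us)" and "ly = 2 \<cdot>\<^sub>v (QQ *\<^sub>v ys)"
  have lu: "lu \<in> carrier_vec (m * N)" and ly: "ly \<in> carrier_vec (p * N)"
    using RR(1) QQ(1) us ys by (auto simp: lu_def ly_def)
  have "2 \<cdot>\<^sub>v (RR *\<^sub>v us) - lu = 0\<^sub>v (m * N)" "2 \<cdot>\<^sub>v (QQ *\<^sub>v ys) - ly = 0\<^sub>v (p * N)"
    using lu ly by (simp_all add: lu_def[symmetric] ly_def[symmetric])
  moreover have "H *\<^sub>v gs - ((uini @\<^sub>v yini) @\<^sub>v us @\<^sub>v ys) = 0\<^sub>v (?a + (m * N + p * N))"
    unfolding eq by (rule minus_cancel_vec) (use w us ys in auto)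
  ultimately show ?thesis
    using lini lu ly stat[folded lu_def ly_def]
      lagrangian_partials[OF H gs w us ys lini lu ly RR QQ]
    by blast
qed

end
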